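(* Let $m\ge2$ and let $0\le p_1\le p_2\le 2$. For $p\in\{p_1,p_2\}$ let $\sigma_{p}$ denote the unique zero in $(\lambda_m,\infty)$ of $$f_p(\sigma)= \frac{1}{m} \sum_{i=1}^m (\sigma - \lambda_i)^p - \frac{2\beta}{\gamma N}\, \frac{1}{m} \sum_{i=1}^m (\sigma - \lambda_i)^{p-1}\lambda_i .$$ Then $$\lambda_{m+1}\le\sigma_{p_2}\le\sigma_{p_1}.$$
   Context: $\mathcal{H}$ is a complex Hilbert space with inner product $\langle\cdot,\cdot\rangle$ and norm $\|u\|=\sqrt{\langle u,u\rangle}$. $A:\mathcal{D}\subset\mathcal{H}\to\mathcal{H}$ is a self-adjoint operator defined on a dense domain $\mathcal{D}$, semibounded below, with discrete spectrum $\lambda_1\le\lambda_2\le\lambda_3\le\cdots$ (eigenvalues listed with multiplicity). $\{u_i\}_{i=1}^\infty$ are normalized eigenvectors, $Au_i=\lambda_iu_i$, forming an orthonormal basis of $\mathcal{H}$. $B_1,\dots,B_N$ are symmetric operators, defined on $\mathcal{D}$ and on $A(\mathcal{D})$ with values in $\mathcal{H}$, which leave $\mathcal{D}$ invariant. The commutator is $[A,B]=AB-BA$. It is assumed that there are constants $\beta,\gamma>0$ with $$\gamma\le[B_k,[A,B_k]]\quad(1\le k\le N),\qquad -\sum_{k=1}^N[A,B_k]^2\le\beta A .$$ Here, for a symmetric operator $C$ and $\alpha\in\mathbb{R}$, $C\ge\alpha$ means $\langle Cu,u\rangle\ge\alpha\langle u,u\rangle$ for all $u\in\mathcal{D}(C)$;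 for symmetric operators $C,D$, $C\ge D$ means $\mathcal{D}(D)\subset\mathcal{D}(C)$ and $C-D\ge0$ on $\mathcal{D}(D)$. The eigenvectors $u_i$ are understood to belong to the domains of the operators in these two inequalities. *)

theory Defs
  imports "HOL-Analysis.Analysis"
begin

(* The libraries only provide real inner product spaces.  A complex Hilbert space is a real one
   carrying a compatible complex structure; the norm is then sqrt (Re (cinner x x)).  The inner
   product is linear in its first argument. *)
class complex_hilbert = real_inner + complete_space +
  fixes scaleC :: "complex \<Rightarrow> 'a \<Rightarrow> 'a"  (infixr "*\<^sub>C" 75)
    and cinner :: "'a \<Rightarrow> 'a \<Rightarrow> complex"
  assumes scaleC_add_right: "a *\<^sub>C (x + y) = a *\<^sub>C x + a *\<^sub>C y"
    and scaleC_add_left: "(a + b) *\<^sub>C x = a *\<^sub>C x + b *\<^sub>C x"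
    and scaleC_scaleC: "a *\<^sub>C (b *\<^sub>C x) = (a * b) *\<^sub>C x"
    and scaleR_scaleC: "r *\<^sub>R x = complex_of_real r *\<^sub>C x"
    and cinner_commute: "cinner x y = cnj (cinner y x)"
    and cinner_add_left: "cinner (x + y) z = cinner x z + cinner y z"
    and cinner_scaleC_left: "cinner (a *\<^sub>C x) y = a * cinner x y"
    and inner_eq_Re_cinner: "inner x y = Re (cinner x y)"

(* Orthonormal (Hilbert) basis: every vector has the expansion sum <x, e i> e i. *)
definition orthonormal_basis :: "(nat \<Rightarrow> 'a::complex_hilbert) \<Rightarrow> bool" where
  "orthonormal_basis e \<longleftrightarrow>
     (\<forall>i j. cinner (e i) (e j) = (if i = j then 1 else 0)) \<and>
     (\<forall>x. (\<lambda>i. cinner x (e i) *\<^sub>C e i) sums x)"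

(* A possibly unbounded operator: op_app is only meaningful on op_dom. *)
datatype 'a operator = Operator (op_dom: "'a set") (op_app: "'a \<Rightarrow> 'a")

definition linear_op :: "'a::complex_hilbert operator \<Rightarrow> bool" where
  "linear_op T \<longleftrightarrow> 0 \<in> op_dom T \<and>
     (\<forall>x\<in>op_dom T. \<forall>y\<in>op_dom T.
        x + y \<in> op_dom T \<and> op_app T (x + y) = op_app T x + op_app T y) \<and>
     (\<forall>a. \<forall>x\<in>op_dom T. a *\<^sub>C x \<in> op_dom T \<and> op_app T (a *\<^sub>C x) = a *\<^sub>C op_app T x)"

definition symmetric_op :: "'a::complex_hilbert operator \<Rightarrow> bool" where
  "symmetric_op T \<longleftrightarrow> linear_op T \<and>
     (\<forall>x\<in>op_dom T. \<forall>y\<in>op_dom T. cinner (op_app T x) y = cinner x (op_app T y))"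

(* The last conjunct says that T and its adjoint have the same graph: the right-hand side of the
   equivalence is the statement that v lies in the domain of the adjoint, with value w there. *)
definition self_adjoint_op :: "'a::complex_hilbert operator \<Rightarrow> bool" where
  "self_adjoint_op T \<longleftrightarrow> linear_op T \<and> closure (op_dom T) = UNIV \<and>
     (\<forall>v w. (v \<in> op_dom T \<and> op_app T v = w) \<longleftrightarrow>
            (\<forall>x\<in>op_dom T. cinner (op_app T x) v = cinner x w))"

(* Domains are the natural ones. *)
definition op_comp :: "'a operator \<Rightarrow> 'a operator \<Rightarrow> 'a operator" where
  "op_comp S T = Operator {x \<in> op_dom T. op_app T x \<in> op_dom S} (\<lambda>x. op_app S (op_app T x))"

definition op_diff :: "'a::complex_hilbert operator \<Rightarrow> 'a operator \<Rightarrow> 'a operator" where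
  "op_diff S T = Operator (op_dom S \<inter> op_dom T) (\<lambda>x. op_app S x - op_app T x)"

definition op_scale :: "complex \<Rightarrow> 'a::complex_hilbert operator \<Rightarrow> 'a operator" where
  "op_scale a T = Operator (op_dom T) (\<lambda>x. a *\<^sub>C op_app T x)"

definition op_sum :: "'k set \<Rightarrow> ('k \<Rightarrow> 'a::complex_hilbert operator) \<Rightarrow> 'a operator" where
  "op_sum K T = Operator (\<Inter>k\<in>K. op_dom (T k)) (\<lambda>x. \<Sum>k\<in>K. op_app (T k) x)"

definition commutator :: "'a::complex_hilbert operator \<Rightarrow> 'a operator \<Rightarrow> 'a operator" where
  "commutator S T = op_diff (op_comp S T) (op_comp T S)"

(* Used for symmetric operators, whose quadratic form is real, so taking Re loses nothing. *)
definition op_ge_const :: "'a::complex_hilbert operator \<Rightarrow> real \<Rightarrow> bool" where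
  "op_ge_const T \<alpha> \<longleftrightarrow> (\<forall>x\<in>op_dom T. Re (cinner (op_app T x) x) \<ge> \<alpha> * Re (cinner x x))"

definition op_ge :: "'a::complex_hilbert operator \<Rightarrow> 'a operator \<Rightarrow> bool" where
  "op_ge S T \<longleftrightarrow> op_dom T \<subseteq> op_dom S \<and> op_ge_const (op_diff S T) 0"

definition semibounded_below :: "'a::complex_hilbert operator \<Rightarrow> bool" where
  "semibounded_below T \<longleftrightarrow> (\<exists>\<alpha>. op_ge_const T \<alpha>)"

definition op_resolvent_set :: "'a::complex_hilbert operator \<Rightarrow> complex set" where
  "op_resolvent_set T = {z. bij_betw (\<lambda>x. op_app T x - z *\<^sub>C x) (op_dom T) UNIV \<and>
      (\<exists>K. \<forall>x\<in>op_dom T. norm x \<le> K * norm (op_app T x - z *\<^sub>C x))}"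

definition op_spectrum :: "'a::complex_hilbert operator \<Rightarrow> complex set" where
  "op_spectrum T = - op_resolvent_set T"

definition op_eigenspace :: "'a::complex_hilbert operator \<Rightarrow> complex \<Rightarrow> 'a set" where
  "op_eigenspace T z = {x \<in> op_dom T. op_app T x = z *\<^sub>C x}"

(* Isolated eigenvalues of finite multiplicity only.  The library's span is the real one, but
   finite dimensionality over the reals and over the complex numbers coincide. *)
definition discrete_spectrum :: "'a::complex_hilbert operator \<Rightarrow> bool" where
  "discrete_spectrum T \<longleftrightarrow>
     (\<forall>z\<in>op_spectrum T. z isolated_in op_spectrum T \<and> op_eigenspace T z \<noteq> {0} \<and>
        (\<exists>F. finite F \<and> op_eigenspace T z \<subseteq> span F))"

(* Eigenvalues are numbered from 1.  All bases of powr are positive where f_fun is used, that is,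
   for \<sigma> > lam m. *)
definition f_fun :: "(nat \<Rightarrow> real) \<Rightarrow> nat \<Rightarrow> nat \<Rightarrow> real \<Rightarrow> real \<Rightarrow> real \<Rightarrow> real \<Rightarrow> real" where
  "f_fun lam m N \<beta> \<gamma> p \<sigma> =
     1 / real m * (\<Sum>i=1..m. (\<sigma> - lam i) powr p)
     - 2 * \<beta> / (\<gamma> * real N) * (1 / real m) * (\<Sum>i=1..m. (\<sigma> - lam i) powr (p - 1) * lam i)"

end

theory Submission
  imports Defs
begin

text \<open>Expanding \<open>B k (u i)\<close> and \<open>[A, B k] (u i)\<close> in the eigenbasis, with
  \<open>a i j = (\<Sum>k. |\<langle>B k (u i), u j\<rangle>|\<^sup>2)\<close> symmetric in \<open>i\<close> and \<open>j\<close>, the hypotheses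
  read \<open>(\<Sum>j. (lam j - lam i) * a i j) \<ge> \<gamma> * N / 2\<close> and
  \<open>(\<Sum>j. (lam j - lam i)\<^sup>2 * a i j) \<le> \<beta> * lam i\<close>. Weighting these by
  \<open>(z - lam i)\<^sup>2\<close> and \<open>z - lam i\<close> gives \<open>f 2 z \<le> 0\<close> for \<open>z\<close> between
  \<open>lam m\<close> and \<open>lam (m + 1)\<close>, and all eigenvalues turn out to be positive. Up to the factor
  \<open>1 / m\<close>, \<open>f p \<sigma>\<close> is the sum of \<open>(\<sigma> - lam i) powr (p - 1) * (\<sigma> - (1 + \<tau>) * lam i)\<close>
  with \<open>\<tau> = 2 * \<beta> / (\<gamma> * N)\<close>; raising \<open>p\<close> shifts weight to the terms with small
  \<open>lam i\<close>, which are the positive ones. So \<open>f p \<sigma> \<ge> 0\<close> implies \<open>f q \<sigma> \<ge> 0\<close> for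
  \<open>q \<ge> p\<close>, and since each \<open>f p\<close> changes sign only once beyond \<open>lam m\<close>, the zeros are
  ordered and lie beyond \<open>lam (m + 1)\<close>.\<close>

section \<open>Complex inner products and Parseval's identity\<close>

lemma cinner_scaleC_right: "cinner x (a *\<^sub>C y) = cnj a * cinner x y"
  by (metis cinner_commute cinner_scaleC_left complex_cnj_mult)

lemma cinner_diff_left: "cinner (x - y) z = cinner x z - cinner y z"
  by (metis add_diff_cancel_right' cinner_add_left diff_add_cancel)

lemma cinner_diff_right: "cinner x (y - z) = cinner x y - cinner x z"
  by (metis cinner_commute cinner_diff_left complex_cnj_diff)

lemma cinner_sum_left: "cinner (sum f K) z = (\<Sum>k\<in>K. cinner (f k) z)"
proof (induction K rule: infinite_finite_induct)
  have "cinner (0::'a) z = 0" using cinner_diff_left[of z z z] by simp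
  then show "cinner (sum f K) z = (\<Sum>k\<in>K. cinner (f k) z)" if "infinite K" for K :: "'b set"
    using that by simp
  show "cinner (sum f {}) z = (\<Sum>k\<in>{}. cinner (f k) z)"
    using \<open>cinner (0::'a) z = 0\<close> by simp
qed (simp add: cinner_add_left)

text \<open>Pair the basis expansion of \<open>x\<close> with \<open>y\<close> term by term in the
  real inner product, which is bounded linear; hence the real parts.\<close>

lemma parseval:
  assumes "orthonormal_basis e"
  shows "(\<lambda>j. Re (cinner x (e j) * cnj (cinner y (e j)))) sums Re (cinner x y)"
proof -
  have "(\<lambda>j. cinner x (e j) *\<^sub>C e j) sums x"
    using assms by (simp add: orthonormal_basis_def)
  then have "(\<lambda>j. inner (cinner x (e j) *\<^sub>C e j) y) sums inner x y"
    by (rule bounded_linear.sums[OF bounded_linear_inner_left])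
  moreover have "inner (cinner x (e j) *\<^sub>C e j) y = Re (cinner x (e j) * cnj (cinner y (e j)))" for j
    by (simp only: inner_eq_Re_cinner cinner_scaleC_left cinner_commute[of "e j" y])
  ultimately show ?thesis
    by (simp add: inner_eq_Re_cinner[of x y])
qed

section \<open>Commutators of symmetric operators and the trace inequality\<close>

lemma self_adjoint_op_imp_symmetric_op: "self_adjoint_op T \<Longrightarrow> symmetric_op T"
  unfolding self_adjoint_op_def symmetric_op_def by blast

lemma symmetric_opD:
  "symmetric_op T \<Longrightarrow> x \<in> op_dom T \<Longrightarrow> y \<in> op_dom T \<Longrightarrow>
    cinner (op_app T x) y = cinner x (op_app T y)"
  by (simp add: symmetric_op_def)

lemma op_dom_commutator:
  "x \<in> op_dom (commutator S T) \<longleftrightarrow>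
    x \<in> op_dom T \<and> op_app T x \<in> op_dom S \<and> x \<in> op_dom S \<and> op_app S x \<in> op_dom T"
  by (auto simp: commutator_def op_diff_def op_comp_def)

lemma op_app_commutator:
  "op_app (commutator S T) x = op_app S (op_app T x) - op_app T (op_app S x)"
  by (simp add: commutator_def op_diff_def op_comp_def)

text \<open>Moving both factors across turns \<open>S T\<close> into \<open>T S\<close>. For
  commutators with \<open>A\<close> this converts minus a square into a squared norm.\<close>

lemma commutator_skew:
  assumes "symmetric_op S" "symmetric_op T"
    and "x \<in> op_dom (commutator S T)" "y \<in> op_dom (commutator S T)"
  shows "cinner (op_app (commutator S T) x) y = - cinner x (op_app (commutator S T) y)"
  using assms by (simp add: op_dom_commutator op_app_commutator cinner_diff_left cinner_diff_right symmetric_opD)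

text \<open>The two terms of the outer commutator are complex conjugates: one moves \<open>T\<close>
  to the right, the other uses skewness of the inner commutator.\<close>

lemma double_commutator_form:
  assumes "symmetric_op S" "symmetric_op T"
    and "x \<in> op_dom (commutator T (commutator S T))"
  shows "Re (cinner (op_app (commutator T (commutator S T)) x) x) =
    2 * Re (cinner (op_app (commutator S T) x) (op_app T x))"
proof -
  let ?C = "commutator S T"
  have d: "x \<in> op_dom ?C" "op_app ?C x \<in> op_dom T" "x \<in> op_dom T" "op_app T x \<in> op_dom ?C"
    using assms(3) by (simp_all add: op_dom_commutator[of x T ?C])
  have "cinner (op_app (commutator T ?C) x) x
      = cinner (op_app ?C x) (op_app T x) + cinner (op_app T x) (op_app ?C x)"
    using d assms(1,2)
    by (simp add: op_app_commutator[of T ?C] cinner_diff_left symmetric_opD[OF assms(2)] commutator_skew)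
  then show ?thesis
    by (subst (asm) (2) cinner_commute) simp
qed

text \<open>In \<open>S T\<close> the factor \<open>S\<close> moves onto \<open>y\<close> and yields
  \<open>b\<close>; in \<open>T S\<close> it acts on \<open>x\<close> and yields
  \<open>a\<close>.\<close>

lemma commutator_matrix_element:
  assumes S: "symmetric_op S" and T: "symmetric_op T"
    and x: "x \<in> op_dom (commutator S T)" "op_app S x = complex_of_real a *\<^sub>C x"
    and y: "y \<in> op_dom S" "op_app S y = complex_of_real b *\<^sub>C y"
  shows "cinner (op_app (commutator S T) x) y = complex_of_real (b - a) * cinner (op_app T x) y"
proof -
  have "op_app T (complex_of_real a *\<^sub>C x) = complex_of_real a *\<^sub>C op_app T x"
    using T x by (simp add: op_dom_commutator symmetric_op_def linear_op_def)
  then show ?thesis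
    using S x y
    by (simp add: op_dom_commutator op_app_commutator cinner_diff_left cinner_scaleC_left
        cinner_scaleC_right symmetric_opD[OF S] left_diff_distrib)
qed

text \<open>Multiplying the \<open>j\<close>-th terms by \<open>z - l i\<close> and \<open>(z - l i)\<^sup>2\<close>, the difference is
  \<open>(z - l i) * (l j - l i) * (l j - z) * a i j\<close>: antisymmetric on the first \<open>m\<close> indices and
  nonnegative for \<open>j\<close> beyond them.\<close>

lemma yang_trace_inequality:
  fixes l S T :: "nat \<Rightarrow> real" and a :: "nat \<Rightarrow> nat \<Rightarrow> real"
  assumes sym: "\<And>i j. a i j = a j i" and nonneg: "\<And>i j. 0 \<le> a i j"
    and S: "\<And>i. (\<lambda>j. (l j - l i) * a i j) sums S i"
    and T: "\<And>i. (\<lambda>j. (l j - l i)\<^sup>2 * a i j) sums T i"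
    and below: "\<And>i. i < m \<Longrightarrow> l i \<le> z" and above: "\<And>j. m \<le> j \<Longrightarrow> z \<le> l j"
  shows "(\<Sum>i<m. (z - l i)\<^sup>2 * S i) \<le> (\<Sum>i<m. (z - l i) * T i)"
proof -
  define D where "D i j = (z - l i) * (l j - l i) * (l j - z) * a i j" for i j
  have "(\<lambda>j. (z - l i) * ((l j - l i)\<^sup>2 * a i j) - (z - l i)\<^sup>2 * ((l j - l i) * a i j))
      sums ((z - l i) * T i - (z - l i)\<^sup>2 * S i)" for i
    by (intro sums_diff sums_mult S T)
  moreover have "(z - l i) * ((l j - l i)\<^sup>2 * a i j) - (z - l i)\<^sup>2 * ((l j - l i) * a i j) = D i j" for i j
    by (simp add: D_def power2_eq_square algebra_simps)
  ultimately have "D i sums ((z - l i) * T i - (z - l i)\<^sup>2 * S i)" for i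
    by simp
  then have sums: "(\<lambda>j. \<Sum>i<m. D i j) sums (\<Sum>i<m. (z - l i) * T i - (z - l i)\<^sup>2 * S i)"
    by (intro sums_sum) auto
  have "(\<Sum>j<m. \<Sum>i<m. D i j) = (\<Sum>j<m. \<Sum>i<m. D j i)"
    by (rule sum.swap)
  also have "\<dots> = - (\<Sum>j<m. \<Sum>i<m. D i j)"
  proof -
    have "D j i = - D i j" for i j
      using sym[of i j] by (simp add: D_def algebra_simps)
    then show ?thesis
      unfolding sum_negf[symmetric] by (intro sum.cong refl)
  qed
  finally have "0 = (\<Sum>j<m. \<Sum>i<m. D i j)" by linarith
  also have "\<dots> \<le> (\<Sum>j. \<Sum>i<m. D i j)"
  proof (rule sum_le_suminf)
    show "0 \<le> (\<Sum>i<m. D i j)" if "j \<in> - {..<m}" for j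
      using below above[of j] nonneg that unfolding D_def
      by (intro sum_nonneg mult_nonneg_nonneg) (auto intro: order.trans)
  qed (use sums sums_summable in auto)
  also have "\<dots> = (\<Sum>i<m. (z - l i) * T i - (z - l i)\<^sup>2 * S i)"
    using sums by (rule sums_unique[symmetric])
  finally show ?thesis by (simp add: sum_subtractf)
qed

text \<open>Parseval applied to the matrix elements of the commutator. Summed over the operators,
  these become the two series in \<open>yang_trace_inequality\<close>.\<close>

lemma commutator_sums:
  assumes "symmetric_op S" "symmetric_op T" "orthonormal_basis e"
    and eig: "\<And>j. e j \<in> op_dom S \<and> op_app S (e j) = complex_of_real (l j) *\<^sub>C e j"
    and dom: "e i \<in> op_dom (commutator S T)"
  shows "(\<lambda>j. (l j - l i) * (cmod (cinner (op_app T (e i)) (e j)))\<^sup>2) sums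
      Re (cinner (op_app (commutator S T) (e i)) (op_app T (e i)))"
    and "(\<lambda>j. (l j - l i)\<^sup>2 * (cmod (cinner (op_app T (e i)) (e j)))\<^sup>2) sums
      Re (cinner (op_app (commutator S T) (e i)) (op_app (commutator S T) (e i)))"
proof -
  have C: "cinner (op_app (commutator S T) (e i)) (e j)
      = complex_of_real (l j - l i) * cinner (op_app T (e i)) (e j)" for j
    by (rule commutator_matrix_element) (use assms in auto)
  have z: "Re (complex_of_real r * z * cnj z) = r * (cmod z)\<^sup>2" for r z
    by (simp add: mult.assoc complex_norm_square[symmetric])
  have z2: "Re (complex_of_real r * z * cnj (complex_of_real r * z)) = r\<^sup>2 * (cmod z)\<^sup>2" for r z
    using z[of "r * r" z] by (simp add: power2_eq_square mult_ac)
  show "(\<lambda>j. (l j - l i) * (cmod (cinner (op_app T (e i)) (e j)))\<^sup>2) sums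
      Re (cinner (op_app (commutator S T) (e i)) (op_app T (e i)))"
    using parseval[OF \<open>orthonormal_basis e\<close>, of "op_app (commutator S T) (e i)" "op_app T (e i)"]
    unfolding C z .
  show "(\<lambda>j. (l j - l i)\<^sup>2 * (cmod (cinner (op_app T (e i)) (e j)))\<^sup>2) sums
      Re (cinner (op_app (commutator S T) (e i)) (op_app (commutator S T) (e i)))"
    using parseval[OF \<open>orthonormal_basis e\<close>,
        of "op_app (commutator S T) (e i)" "op_app (commutator S T) (e i)"]
    unfolding C z2 .
qed

section \<open>Convexity and concavity of powers, with 0 included\<close>

text \<open>The point 0 matters because \<open>l m - l i\<close> vanishes at \<open>i = m\<close>;
  there the claim reduces to \<open>t powr p \<le> t\<close>, or the same for
  \<open>1 - t\<close>.\<close>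

lemma powr_convex_nonneg:
  fixes a b t p :: real
  assumes "0 \<le> a" "0 \<le> b" "0 \<le> t" "t \<le> 1" "1 \<le> p"
  shows "((1 - t) * a + t * b) powr p \<le> (1 - t) * a powr p + t * b powr p"
proof -
  have le: "s powr p \<le> s" if "0 \<le> s" "s \<le> 1" for s :: real
    using powr_mono'[of 1 p s] that assms by simp
  show ?thesis
  proof (cases "a = 0 \<or> b = 0")
    case True
    then show ?thesis
      using assms le[of t] le[of "1 - t"]
      by (auto simp: powr_mult intro!: mult_right_mono)
  next
    case False
    then show ?thesis
      using convex_onD[OF powr_convex[OF \<open>1 \<le> p\<close>], of t a b] assms by simp
  qed
qed

text \<open>Apply convexity with exponent \<open>1 / q\<close> to the \<open>q\<close>-th powers,
  then raise the result to the power \<open>q\<close>.\<close>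

lemma powr_concave_nonneg:
  fixes a b t q :: real
  assumes "0 \<le> a" "0 \<le> b" "0 \<le> t" "t \<le> 1" "0 < q" "q \<le> 1"
  shows "(1 - t) * a powr q + t * b powr q \<le> ((1 - t) * a + t * b) powr q"
proof -
  let ?s = "(1 - t) * a powr q + t * b powr q"
  have "?s powr (1 / q) \<le> (1 - t) * (a powr q) powr (1 / q) + t * (b powr q) powr (1 / q)"
    by (rule powr_convex_nonneg) (use assms in auto)
  also have "\<dots> = (1 - t) * a + t * b"
    using assms by (simp add: powr_powr)
  finally have "(?s powr (1 / q)) powr q \<le> ((1 - t) * a + t * b) powr q"
    using assms by (intro powr_mono2) auto
  moreover have "0 \<le> ?s" using assms by simp
  ultimately show ?thesis using assms by (simp add: powr_powr)
qed

section \<open>Signs of the power sums at and beyond the last eigenvalue\<close>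

definition yang_sum :: "(nat \<Rightarrow> real) \<Rightarrow> nat \<Rightarrow> real \<Rightarrow> real \<Rightarrow> real \<Rightarrow> real" where
  "yang_sum l m \<tau> p s = (\<Sum>i=1..m. (s - l i) powr (p - 1) * (s - (1 + \<tau>) * l i))"

lemma f_fun_eq_yang_sum:
  assumes "\<And>i. i \<in> {1..m} \<Longrightarrow> l i \<le> s"
  shows "f_fun l m N \<beta> \<gamma> p s = yang_sum l m (2 * \<beta> / (\<gamma> * real N)) p s / real m"
proof -
  \<comment> \<open>This includes \<open>s = l i\<close>, since \<open>0 powr x = 0\<close> for
    every exponent.\<close>
  have "(s - l i) powr p = (s - l i) powr (p - 1) * (s - l i)" if "i \<in> {1..m}" for i
    using powr_mult_base[of "s - l i" "p - 1"] assms[OF that] by (simp add: mult.commute)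
  then have "(\<Sum>i=1..m. (s - l i) powr p) - c * (\<Sum>i=1..m. (s - l i) powr (p - 1) * l i)
      = yang_sum l m c p s" for c
    unfolding yang_sum_def sum_distrib_left sum_subtractf[symmetric]
    by (intro sum.cong refl) (simp add: algebra_simps)
  note this[of "2 * \<beta> / (\<gamma> * real N)", symmetric]
  then show ?thesis
    unfolding f_fun_def by (simp add: diff_divide_distrib)
qed

text \<open>The numerical data for the sign analysis; \<open>yang_last\<close> is the trace
  inequality at the endpoint \<open>z = l m\<close>.\<close>

locale yang_bound =
  fixes l :: "nat \<Rightarrow> real" and m :: nat and \<tau> :: real
  assumes l_pos: "\<And>i. i \<in> {1..m} \<Longrightarrow> 0 < l i"
    and l_le: "\<And>i. i \<in> {1..m} \<Longrightarrow> l i \<le> l m"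
    and m_pos: "1 \<le> m"
    and \<tau>_pos: "0 < \<tau>"
    and yang_last: "yang_sum l m \<tau> 2 (l m) \<le> 0"
begin

abbreviation g :: "real \<Rightarrow> real \<Rightarrow> real" where
  "g \<equiv> yang_sum l m \<tau>"

text \<open>The value of \<open>s - l i\<close> at which the factor
  \<open>s - (1 + \<tau>) * l i\<close> changes sign.\<close>

definition thr :: "real \<Rightarrow> real" where
  "thr s = s * \<tau> / (1 + \<tau>)"

lemma last_pos: "0 < l m"
  using l_pos[of m] m_pos by simp

lemma thr_pos: "l m \<le> s \<Longrightarrow> 0 < thr s"
  using last_pos \<tau>_pos by (simp add: thr_def)

lemma factor_sign: "0 \<le> s - (1 + \<tau>) * l i \<longleftrightarrow> thr s \<le> s - l i"
  using \<tau>_pos by (simp add: thr_def field_simps)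

text \<open>The extra weight \<open>(s - l i) powr (q - p)\<close> is at least its value at the
  pivot \<open>thr s\<close> where the second factor is nonnegative, and at most that value where it
  is negative.\<close>

lemma g_weighted_mono:
  assumes "l m \<le> s" "p \<le> q" and i: "i \<in> {1..m}"
  shows "thr s powr (q - p) * ((s - l i) powr (p - 1) * (s - (1 + \<tau>) * l i))
    \<le> (s - l i) powr (q - 1) * (s - (1 + \<tau>) * l i)"
proof -
  let ?x = "s - l i" and ?y = "s - (1 + \<tau>) * l i"
  have x: "0 \<le> ?x" using l_le[OF i] assms by simp
  have "thr s powr (q - p) * ?y \<le> ?x powr (q - p) * ?y"
  proof (cases "0 \<le> ?y")
    case True
    then show ?thesis
      using thr_pos[OF assms(1)] factor_sign[of s i] assms
      by (intro mult_right_mono powr_mono2) auto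
  next
    case False
    then show ?thesis
      using x factor_sign[of s i] assms
      by (intro mult_right_mono_neg powr_mono2) auto
  qed
  then have "?x powr (p - 1) * (thr s powr (q - p) * ?y) \<le> ?x powr (p - 1) * (?x powr (q - p) * ?y)"
    by (intro mult_left_mono) auto
  moreover have "?x powr (p - 1) * ?x powr (q - p) = ?x powr (q - 1)"
    by (simp add: powr_add[symmetric])
  ultimately show ?thesis
    by (simp add: mult_ac)
qed

lemma g_weighted_mono_sum:
  assumes "l m \<le> s" "p \<le> q"
  shows "thr s powr (q - p) * g p s \<le> g q s"
  unfolding yang_sum_def sum_distrib_left
  by (intro sum_mono g_weighted_mono assms)

lemma g_pos_mono:
  assumes "l m \<le> s" "p \<le> q" "0 < g p s"
  shows "0 < g q s"
proof -
  have "0 < thr s powr (q - p) * g p s"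
    using assms thr_pos[of s] by simp
  then show ?thesis
    using g_weighted_mono_sum[OF assms(1,2)] by linarith
qed

lemma g_nonneg_mono:
  assumes "l m \<le> s" "p \<le> q" "0 \<le> g p s"
  shows "0 \<le> g q s"
proof -
  have "0 \<le> thr s powr (q - p) * g p s"
    using assms by simp
  then show ?thesis
    using g_weighted_mono_sum[OF assms(1,2)] by linarith
qed

text \<open>For \<open>p \<le> 1\<close> the weight \<open>((x + h) / x) powr (p - 1)\<close>, where \<open>x = s - l i\<close> and
  \<open>h = s' - s\<close>, is increasing in \<open>x\<close>, so shifting \<open>s\<close> favours the positive terms.\<close>

lemma g_crossing_small:
  assumes "l m < s" "s < s'" "p \<le> 1" "0 \<le> g p s"
  shows "0 < g p s'"
proof -
  define h where "h = s' - s"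
  have h: "0 < h" "s' = s + h" using assms by (auto simp: h_def)
  \<comment> \<open>The weight ratio at the pivot \<open>thr s\<close>, used as a common factor for
    all terms.\<close>
  define c where "c = ((thr s + h) / thr s) powr (p - 1)"
  have t: "0 < thr s" using thr_pos[of s] assms by simp
  have step: "c * ((s - l i) powr (p - 1) * (s - (1 + \<tau>) * l i))
      < (s' - l i) powr (p - 1) * (s' - (1 + \<tau>) * l i)" if i: "i \<in> {1..m}" for i
  proof -
    let ?x = "s - l i" and ?y = "s - (1 + \<tau>) * l i"
    have x: "0 < ?x" using l_le[OF i] assms by simp
    let ?r = "((?x + h) / ?x) powr (p - 1)"
    have "c * ?y \<le> ?r * ?y"
    proof (cases "0 \<le> ?y")
      case True
      then have "thr s \<le> ?x" using factor_sign by blast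
      then have "(?x + h) / ?x \<le> (thr s + h) / thr s"
        using x t h by (simp add: add_divide_distrib frac_le)
      then show ?thesis
        unfolding c_def using x t h True assms
        by (intro mult_right_mono powr_mono2') auto
    next
      case False
      then have "?x \<le> thr s" using factor_sign[of s i] by linarith
      then have "(thr s + h) / thr s \<le> (?x + h) / ?x"
        using x t h by (simp add: add_divide_distrib frac_le)
      then show ?thesis
        unfolding c_def using x t h False assms
        by (intro mult_right_mono_neg powr_mono2') auto
    qed
    then have "?x powr (p - 1) * (c * ?y) \<le> ?x powr (p - 1) * (?r * ?y)"
      by (intro mult_left_mono) auto
    also have "\<dots> = (?x * ((?x + h) / ?x)) powr (p - 1) * ?y"
      by (subst powr_mult) (simp only: mult.assoc)
    also have "?x * ((?x + h) / ?x) = s' - l i"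
      using x h by simp
    \<comment> \<open>Strictness: the second factor grows by \<open>h\<close> and its weight is
      positive.\<close>
    also have "(s' - l i) powr (p - 1) * ?y < (s' - l i) powr (p - 1) * (s' - (1 + \<tau>) * l i)"
      using x h by (intro mult_strict_left_mono) auto
    finally show ?thesis by (simp add: mult_ac)
  qed
  have "0 \<le> c * g p s" using assms by (simp add: c_def)
  also have "\<dots> < g p s'"
    unfolding yang_sum_def sum_distrib_left
    using m_pos by (intro sum_strict_mono step) auto
  finally show ?thesis .
qed

text \<open>Positivity would propagate to exponent 2, against \<open>yang_last\<close>.\<close>

lemma g_last_nonpos:
  assumes "p \<le> 2"
  shows "g p (l m) \<le> 0"
  using g_pos_mono[of "l m" p 2] assms yang_last by fastforce

text \<open>Here \<open>g p\<close> is convex from \<open>l m\<close> on: \<open>p\<close>-th powers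
  are convex, and the subtracted powers \<open>p - 1\<close> are concave with positive coefficients.
  Being nonpositive at \<open>l m\<close> and nonnegative at \<open>s\<close>, it is positive later,
  given one strict term.\<close>

lemma g_crossing_large:
  assumes "l m < s" "s < s'" "1 < p" "p \<le> 2" "0 \<le> g p s"
  shows "0 < g p s'"
proof -
  \<comment> \<open>Chosen so that \<open>s = (1 - t) * l m + t * s'\<close>.\<close>
  define t where "t = (s - l m) / (s' - l m)"
  have t: "0 < t" "t < 1" using assms by (auto simp: t_def)
  have ts: "t * (s' - l m) = s - l m" using assms by (simp add: t_def)
  have split: "(s - l i) powr (p - 1) * (s - (1 + \<tau>) * l i)
      = (s - l i) powr p - \<tau> * l i * (s - l i) powr (p - 1)" if "l i \<le> s" for i and s :: real
    using powr_mult_base[of "s - l i" "p - 1"] that by (simp add: algebra_simps)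
  define \<phi> where "\<phi> i s = (s - l i) powr p - \<tau> * l i * (s - l i) powr (p - 1)" for i s
  have g: "g p r = (\<Sum>i=1..m. \<phi> i r)" if "l m \<le> r" for r
    unfolding yang_sum_def \<phi>_def using l_le that
    by (intro sum.cong split refl) (meson order.trans)
  have comb: "s - l i = (1 - t) * (l m - l i) + t * (s' - l i)" for i
    using ts by (simp add: algebra_simps)
  have le: "\<phi> i s \<le> (1 - t) * \<phi> i (l m) + t * \<phi> i s'" if i: "i \<in> {1..m}" for i
  proof -
    have *: "0 \<le> l m - l i" "0 \<le> s' - l i" "0 \<le> t" "t \<le> 1"
      using l_le[OF i] assms t by auto
    have "(s - l i) powr p \<le> (1 - t) * (l m - l i) powr p + t * (s' - l i) powr p"
      unfolding comb[of i] by (rule powr_convex_nonneg) (use * assms in auto)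
    moreover have "(1 - t) * (l m - l i) powr (p - 1) + t * (s' - l i) powr (p - 1)
        \<le> (s - l i) powr (p - 1)"
      unfolding comb[of i] by (rule powr_concave_nonneg) (use * assms in auto)
    then have "\<tau> * l i * ((1 - t) * (l m - l i) powr (p - 1) + t * (s' - l i) powr (p - 1))
        \<le> \<tau> * l i * (s - l i) powr (p - 1)"
      using l_pos[OF i] \<tau>_pos by (intro mult_left_mono) auto
    ultimately show ?thesis
      unfolding \<phi>_def by (simp add: algebra_simps)
  qed
  \<comment> \<open>The term \<open>i = m\<close> is strict: its base vanishes at
    \<open>l m\<close>, and \<open>t powr p < t\<close>.\<close>
  have "\<phi> m s < (1 - t) * \<phi> m (l m) + t * \<phi> m s'"
  proof -
    have "(s - l m) powr p < t * (s' - l m) powr p"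
    proof -
      have "t powr p < t"
        using powr_less_mono'[of t 1 p] t assms by simp
      then have "t powr p * (s' - l m) powr p < t * (s' - l m) powr p"
        using assms by (intro mult_strict_right_mono) auto
      then show ?thesis
        using t assms by (simp add: ts[symmetric] powr_mult)
    qed
    moreover have "t * (s' - l m) powr (p - 1) \<le> (s - l m) powr (p - 1)"
      using powr_concave_nonneg[of 0 "s' - l m" t "p - 1"] ts t assms by simp
    then have "\<tau> * l m * (t * (s' - l m) powr (p - 1)) \<le> \<tau> * l m * (s - l m) powr (p - 1)"
      using last_pos \<tau>_pos by (intro mult_left_mono) auto
    ultimately show ?thesis
      unfolding \<phi>_def by (simp add: algebra_simps)
  qed
  then have "(\<Sum>i=1..m. \<phi> i s) < (\<Sum>i=1..m. (1 - t) * \<phi> i (l m) + t * \<phi> i s')"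
    using m_pos le by (intro sum_strict_mono_ex1) (auto intro!: bexI[of _ m])
  also have "\<dots> = (1 - t) * (\<Sum>i=1..m. \<phi> i (l m)) + t * (\<Sum>i=1..m. \<phi> i s')"
    by (simp add: sum.distrib sum_distrib_left)
  finally have "g p s < (1 - t) * g p (l m) + t * g p s'"
    using assms by (simp add: g)
  moreover have "(1 - t) * g p (l m) \<le> 0"
    using g_last_nonpos[of p] assms t by (simp add: mult_nonneg_nonpos)
  ultimately have "0 < t * g p s'" using assms by linarith
  then show ?thesis using t by (simp add: zero_less_mult_iff)
qed

section \<open>Uniqueness and existence of the zeros\<close>

lemma g_crossing:
  assumes "l m < s" "s < s'" "p \<le> 2" "0 \<le> g p s"
  shows "0 < g p s'"
  using g_crossing_small[of s s' p] g_crossing_large[of s s' p] assms by linarith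

lemma g_zero_unique:
  assumes "p \<le> 2" "l m < s" "l m < s'" "g p s = 0" "g p s' = 0"
  shows "s = s'"
  using g_crossing[of s s' p] g_crossing[of s' s p] assms by (cases s s' rule: linorder_cases) auto

lemma g_zero_exists:
  assumes "l m < s" "g p s \<le> 0"
  shows "\<exists>\<sigma>>l m. g p \<sigma> = 0"
proof -
  \<comment> \<open>From \<open>(1 + \<tau>) * l m\<close> on every term is nonnegative, which
    provides the right end for the intermediate value theorem.\<close>
  define b where "b = max s ((1 + \<tau>) * l m)"
  have "0 \<le> (b - l i) powr (p - 1) * (b - (1 + \<tau>) * l i)" if i: "i \<in> {1..m}" for i
  proof -
    have "(1 + \<tau>) * l i \<le> (1 + \<tau>) * l m"
      using l_le[OF i] \<tau>_pos by (intro mult_left_mono) auto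
    then show ?thesis by (simp add: b_def)
  qed
  then have "0 \<le> g p b" unfolding yang_sum_def by (intro sum_nonneg) auto
  moreover have "continuous_on {s..b} (g p)"
    unfolding yang_sum_def
    using l_le assms by (intro continuous_intros ballI) force
  ultimately obtain \<sigma> where "s \<le> \<sigma>" "g p \<sigma> = 0"
    using IVT'[of "g p" s 0 b] assms by (auto simp: b_def)
  then show ?thesis using assms by (intro exI[of _ \<sigma>]) auto
qed

text \<open>At \<open>s = l m + e\<close> the term \<open>i = m\<close> is of order \<open>- e powr (p - 1)\<close>, which for \<open>p < 2\<close>
  dominates the at most linear growth of \<open>g 2\<close> away from its nonpositive value at \<open>l m\<close>.\<close>

lemma g_neg_near_last:
  assumes "p < 2"
  shows "\<exists>s>l m. g p s < 0"
proof -
  \<comment> \<open>The linear coefficient of \<open>g 2 (l m + e)\<close> in \<open>e\<close>, plus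
    \<open>m\<close> to absorb the terms \<open>e * e \<le> e\<close>.\<close>
  define C where "C = (\<Sum>i=1..m. (l m - l i) + (l m - (1 + \<tau>) * l i)) + real m"
  have bound2: "g 2 (l m + e) \<le> C * e" if e: "0 < e" "e < 1" for e
  proof -
    have "g 2 (l m + e) = (\<Sum>i=1..m. (l m + e - l i) * (l m + e - (1 + \<tau>) * l i))"
      unfolding yang_sum_def using l_le e by (intro sum.cong) (auto simp: add_increasing2)
    also have "\<dots> = (\<Sum>i=1..m. (l m - l i) * (l m - (1 + \<tau>) * l i)
        + e * ((l m - l i) + (l m - (1 + \<tau>) * l i)) + e * e)"
      by (intro sum.cong) (auto simp: algebra_simps)
    also have "\<dots> = (\<Sum>i=1..m. (l m - l i) * (l m - (1 + \<tau>) * l i))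
        + e * (\<Sum>i=1..m. (l m - l i) + (l m - (1 + \<tau>) * l i)) + real m * (e * e)"
      by (simp only: sum.distrib sum_distrib_left[symmetric]) simp
    also have "(\<Sum>i=1..m. (l m - l i) * (l m - (1 + \<tau>) * l i)) = g 2 (l m)"
      unfolding yang_sum_def using l_le by (intro sum.cong) auto
    also have "real m * (e * e) \<le> real m * e"
      using e by (intro mult_left_mono) (auto simp: mult_le_one)
    finally show ?thesis
      using yang_last by (simp add: C_def algebra_simps)
  qed
  define q where "q = 2 - p"
  have q: "0 < q" using assms by (simp add: q_def)
  \<comment> \<open>Up to the factor \<open>- e powr (p - 1)\<close> this is the final bound on
    \<open>thr s powr q * g p s\<close>. At \<open>e = 0\<close> it equals
    \<open>thr (l m) powr q * (\<tau> * l m)\<close>, which is positive.\<close>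
  have lim: "((\<lambda>e. (thr (l m + e) powr q - e powr q) * (\<tau> * l m - e) - C * e powr q) \<longlongrightarrow>
      (thr (l m + 0) powr q - 0 powr q) * (\<tau> * l m - 0) - C * 0 powr q) (at_right 0)"
    unfolding thr_def using q last_pos \<tau>_pos
    by (intro tendsto_intros tendsto_powr2) 
      (auto intro: eventually_mono[OF eventually_at_right_less])
  have "0 < (thr (l m + 0) powr q - 0 powr q) * (\<tau> * l m - 0) - C * 0 powr q"
    using thr_pos[of "l m"] \<tau>_pos last_pos by simp
  then have "\<forall>\<^sub>F e in at_right 0. 0 < (thr (l m + e) powr q - e powr q) * (\<tau> * l m - e) - C * e powr q"
    using lim by (rule order_tendstoD[rotated])
  moreover have "\<forall>\<^sub>F e in at_right (0::real). 0 < e \<and> e < 1"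
    by (intro eventually_conj eventually_at_right_less) (auto simp: eventually_at_right[of 0 1] intro: exI[of _ 1])
  ultimately have "\<forall>\<^sub>F e in at_right 0. 0 < e \<and> e < 1 \<and>
      0 < (thr (l m + e) powr q - e powr q) * (\<tau> * l m - e) - C * e powr q"
    by eventually_elim auto
  then obtain e where e: "0 < e" "e < 1"
    and pos: "0 < (thr (l m + e) powr q - e powr q) * (\<tau> * l m - e) - C * e powr q"
    using eventually_happens'[of "at_right (0::real)"] by (metis (no_types, lifting) trivial_limit_at_right_real)
  define s where "s = l m + e"
  have ee: "e powr (p - 1) * e powr q = e"
    using e by (simp add: q_def powr_add[symmetric])
  let ?T = "\<lambda>p i. (s - l i) powr (p - 1) * (s - (1 + \<tau>) * l i)"
  let ?k = "thr s powr (2 - p)"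
  have split: "(\<Sum>i=1..m. f i) = (\<Sum>i\<in>{1..m} - {m}. f i) + f m" for f :: "nat \<Rightarrow> real"
    using sum.remove[of "{1..m}" m f] m_pos by simp
  \<comment> \<open>The pivot comparison is applied to all terms but \<open>i = m\<close>, which is
    kept exactly because it carries the negative contribution.\<close>
  have "?k * g p s = (\<Sum>i\<in>{1..m} - {m}. ?k * ?T p i) + ?k * ?T p m"
    unfolding yang_sum_def sum_distrib_left by (rule split)
  also have "\<dots> \<le> (\<Sum>i\<in>{1..m} - {m}. ?T 2 i) + ?k * ?T p m"
    using assms e by (intro add_mono sum_mono g_weighted_mono order.refl) (auto simp: s_def)
  also have "\<dots> = g 2 s - ?T 2 m + ?k * ?T p m"
    unfolding yang_sum_def split[of "?T 2"] by simp
  also have "?T 2 m = e powr (p - 1) * (e powr q * (e - \<tau> * l m))"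
  proof -
    have "?T 2 m = (e powr (p - 1) * e powr q) * (e - \<tau> * l m)"
      unfolding ee using e by (simp add: s_def algebra_simps)
    then show ?thesis by (simp only: mult.assoc)
  qed
  also have "?T p m = e powr (p - 1) * (e - \<tau> * l m)"
    by (simp add: s_def algebra_simps)
  also have "g 2 s \<le> e powr (p - 1) * (C * e powr q)"
  proof -
    have "g 2 s \<le> C * (e powr (p - 1) * e powr q)"
      unfolding ee s_def by (rule bound2[OF e])
    then show ?thesis by (simp only: mult.left_commute)
  qed
  finally have "?k * g p s \<le> - (e powr (p - 1) *
      ((thr (l m + e) powr q - e powr q) * (\<tau> * l m - e) - C * e powr q))"
    by (simp add: s_def q_def algebra_simps)
  also have "\<dots> < 0" using e pos by simp
  finally have "g p s < 0" by (simp add: mult_less_0_iff not_less)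
  then show ?thesis using e by (intro exI[of _ s]) (simp add: s_def)
qed

end

section \<open>From the operator hypotheses to the bounds on the zeros\<close>

theorem theorem14:
  fixes A :: "'h::complex_hilbert operator"
    and B :: "nat \<Rightarrow> 'h operator"
    and u :: "nat \<Rightarrow> 'h"
    and lam :: "nat \<Rightarrow> real"
    and N m :: nat
    and \<beta> \<gamma> p1 p2 :: real
  assumes "self_adjoint_op A" and "semibounded_below A" and "discrete_spectrum A"
    and "\<And>i j. 1 \<le> i \<Longrightarrow> i \<le> j \<Longrightarrow> lam i \<le> lam j"
    and "\<And>i. 1 \<le> i \<Longrightarrow> u i \<in> op_dom A \<and> op_app A (u i) = complex_of_real (lam i) *\<^sub>C u i"
    and "orthonormal_basis (\<lambda>i. u (Suc i))"
    and "1 \<le> N"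
    and "\<And>k. k \<in> {1..N} \<Longrightarrow> symmetric_op (B k)"
    and "\<And>k. k \<in> {1..N} \<Longrightarrow> op_dom A \<subseteq> op_dom (B k)"
    and "\<And>k. k \<in> {1..N} \<Longrightarrow> op_app A ` op_dom A \<subseteq> op_dom (B k)"
    and "\<And>k. k \<in> {1..N} \<Longrightarrow> op_app (B k) ` op_dom A \<subseteq> op_dom A"
    and "0 < \<beta>" and "0 < \<gamma>"
    and "\<And>k. k \<in> {1..N} \<Longrightarrow> op_ge_const (commutator (B k) (commutator A (B k))) \<gamma>"
    and "op_ge (op_scale (complex_of_real \<beta>) A)
           (op_scale (-1) (op_sum {1..N} (\<lambda>k. op_comp (commutator A (B k)) (commutator A (B k)))))"
    and "\<And>i k. 1 \<le> i \<Longrightarrow> k \<in> {1..N} \<Longrightarrow> u i \<in> op_dom (commutator (B k) (commutator A (B k)))"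
    and "\<And>i. 1 \<le> i \<Longrightarrow>
           u i \<in> op_dom (op_scale (-1)
             (op_sum {1..N} (\<lambda>k. op_comp (commutator A (B k)) (commutator A (B k)))))"
    and "2 \<le> m" and "0 \<le> p1" and "p1 \<le> p2" and "p2 \<le> 2"
  shows "(\<forall>p\<in>{p1, p2}. p < 2 \<or> lam m < lam (m + 1) \<longrightarrow>
            (\<exists>!\<sigma>. lam m < \<sigma> \<and> f_fun lam m N \<beta> \<gamma> p \<sigma> = 0)) \<and>
         (\<forall>\<sigma>1 \<sigma>2. lam m < \<sigma>1 \<and> f_fun lam m N \<beta> \<gamma> p1 \<sigma>1 = 0 \<and>
                  lam m < \<sigma>2 \<and> f_fun lam m N \<beta> \<gamma> p2 \<sigma>2 = 0 \<longrightarrow>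
            lam (m + 1) \<le> \<sigma>2 \<and> \<sigma>2 \<le> \<sigma>1)"
proof -
  \<comment> \<open>Indices are shifted to start at 0, where the series start: \<open>i < m\<close>
    for \<open>l\<close> is \<open>{1..m}\<close> for \<open>lam\<close>.\<close>
  define e where "e i = u (Suc i)" for i
  define l where "l i = lam (Suc i)" for i
  define C where "C k = commutator A (B k)" for k
  define a where "a i j = (\<Sum>k\<in>{1..N}. (cmod (cinner (op_app (B k) (e i)) (e j)))\<^sup>2)" for i j
  \<comment> \<open>\<open>S i\<close> is half the summed double commutator forms, whence the bound
    \<open>\<gamma> * N / 2\<close>; \<open>T i\<close> is the sum of the squared norms of
    \<open>C k (e i)\<close>.\<close>
  define S where "S i = (\<Sum>k\<in>{1..N}. Re (cinner (op_app (C k) (e i)) (op_app (B k) (e i))))" for i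
  define T where "T i = (\<Sum>k\<in>{1..N}. Re (cinner (op_app (C k) (e i)) (op_app (C k) (e i))))" for i
  have A: "symmetric_op A"
    using assms(1) by (rule self_adjoint_op_imp_symmetric_op)
  have B: "symmetric_op (B k)" if "k \<in> {1..N}" for k
    using assms(8) that .
  have onb: "orthonormal_basis e"
    using assms(6) by (simp add: e_def[abs_def])
  have e1: "cinner (e i) (e i) = 1" for i
    using onb by (simp add: orthonormal_basis_def)
  have eig: "e j \<in> op_dom A \<and> op_app A (e j) = complex_of_real (l j) *\<^sub>C e j" for j
    using assms(5) by (simp add: e_def l_def)
  have dom2: "e i \<in> op_dom (commutator (B k) (C k))" if "k \<in> {1..N}" for i k
    using assms(16)[of "Suc i" k] that by (simp add: e_def C_def)
  have dom: "e i \<in> op_dom (C k)" if "k \<in> {1..N}" for i k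
    using dom2[OF that] by (simp add: op_dom_commutator[of _ "B k"])
  have sym: "a i j = a j i" for i j
  proof -
    have "cmod (cinner (op_app (B k) (e i)) (e j)) = cmod (cinner (op_app (B k) (e j)) (e i))"
      if "k \<in> {1..N}" for k
    proof -
      have "cinner (op_app (B k) (e i)) (e j) = cinner (e i) (op_app (B k) (e j))"
        using dom[OF that] by (intro symmetric_opD B that) (simp_all add: C_def op_dom_commutator)
      then show ?thesis by (metis cinner_commute complex_mod_cnj)
    qed
    then show ?thesis by (simp add: a_def)
  qed
  have nonneg: "0 \<le> a i j" for i j
    by (simp add: a_def sum_nonneg)
  have S: "(\<lambda>j. (l j - l i) * a i j) sums S i" for i
    unfolding S_def a_def sum_distrib_left C_def
    by (intro sums_sum commutator_sums A B onb eig dom[unfolded C_def])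
  have T: "(\<lambda>j. (l j - l i)\<^sup>2 * a i j) sums T i" for i
    unfolding T_def a_def sum_distrib_left C_def
    by (intro sums_sum commutator_sums A B onb eig dom[unfolded C_def])
  have S_ge: "\<gamma> * real N / 2 \<le> S i" for i
  proof -
    have "\<gamma> / 2 \<le> Re (cinner (op_app (C k) (e i)) (op_app (B k) (e i)))" if k: "k \<in> {1..N}" for k
      using assms(14)[OF k] dom2[OF k, of i] double_commutator_form[OF A B[OF k], of "e i"]
      by (force simp: op_ge_const_def C_def e1)
    then have "(\<Sum>k\<in>{1..N}. \<gamma> / 2) \<le> S i"
      unfolding S_def by (rule sum_mono)
    then show ?thesis by (simp add: mult.commute)
  qed
  have T_le: "T i \<le> \<beta> * l i" for i
  proof -
    have d: "e i \<in> op_dom (C k)" "op_app (C k) (e i) \<in> op_dom (C k)" if "k \<in> {1..N}" for k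
      using assms(17)[of "Suc i"] that by (auto simp: op_scale_def op_sum_def op_comp_def e_def C_def)
    have "e i \<in> op_dom (op_diff (op_scale (complex_of_real \<beta>) A)
        (op_scale (-1) (op_sum {1..N} (\<lambda>k. op_comp (commutator A (B k)) (commutator A (B k))))))"
      using eig d by (auto simp: op_diff_def op_scale_def op_sum_def op_comp_def C_def)
    then have "0 \<le> Re (cinner (complex_of_real \<beta> *\<^sub>C op_app A (e i)
        - (-1) *\<^sub>C (\<Sum>k\<in>{1..N}. op_app (C k) (op_app (C k) (e i)))) (e i))"
      using assms(15) unfolding op_ge_def op_ge_const_def
      by (force simp: op_diff_def op_scale_def op_sum_def op_comp_def C_def)
    also have "\<dots> = \<beta> * l i + (\<Sum>k\<in>{1..N}. Re (cinner (op_app (C k) (op_app (C k) (e i))) (e i)))"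
      using eig by (simp add: cinner_diff_left cinner_scaleC_left cinner_sum_left e1)
    also have "(\<Sum>k\<in>{1..N}. Re (cinner (op_app (C k) (op_app (C k) (e i))) (e i))) = - T i"
      using commutator_skew[OF A B] d by (simp add: T_def C_def sum_negf)
    finally show ?thesis by simp
  qed
  have l_pos: "0 < l i" for i
  proof (rule ccontr)
    assume "\<not> 0 < l i"
    \<comment> \<open>Then \<open>T i = 0\<close>, so each nonnegative term of its series vanishes,
      and with it each term of the series for \<open>S i\<close>. But \<open>S i\<close> is bounded
      below by a positive number.\<close>
    then have "T i \<le> 0" using T_le[of i] assms(12) by (meson mult_nonneg_nonpos not_less order.trans less_imp_le)
    moreover have "0 \<le> T i" by (rule sums_le[OF _ sums_zero T]) (simp add: nonneg)
    ultimately have "T i = 0" by simp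
    then have "(\<Sum>j. (l j - l i)\<^sup>2 * a i j) = 0"
      using sums_unique[OF T[of i]] by simp
    then have zero: "(l j - l i)\<^sup>2 * a i j = 0" for j
      by (subst (asm) suminf_eq_zero_iff[OF sums_summable[OF T]]) (simp_all add: nonneg)
    have "(l j - l i) * a i j = 0" for j
      using zero[of j] by simp
    then have "S i = 0"
      by (intro sums_unique2[OF S] sums_0)
    moreover have "0 < \<gamma> * real N / 2" using assms by simp
    ultimately show False using S_ge[of i] by simp
  qed
  define \<tau> where "\<tau> = 2 * \<beta> / (\<gamma> * real N)"
  have \<tau>: "0 < \<tau>" using assms by (simp add: \<tau>_def)
  have yang: "yang_sum lam m \<tau> 2 z \<le> 0" if z: "lam m \<le> z" "z \<le> lam (m + 1)" for z
  proof -
    have mono: "lam i \<le> lam j" if "1 \<le> i" "i \<le> j" for i j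
      using assms(4) that .
    have below: "l i \<le> z" if "i < m" for i
      using mono[of "Suc i" m] z that by (simp add: l_def)
    have above: "z \<le> l j" if "m \<le> j" for j
      using mono[of "m + 1" "Suc j"] z that by (simp add: l_def)
    have "\<gamma> * real N / 2 * (\<Sum>i<m. (z - l i)\<^sup>2) \<le> (\<Sum>i<m. S i * (z - l i)\<^sup>2)"
      unfolding sum_distrib_left by (intro sum_mono mult_right_mono S_ge zero_le_power2)
    also have "\<dots> = (\<Sum>i<m. (z - l i)\<^sup>2 * S i)"
      by (simp only: mult.commute)
    also have "\<dots> \<le> (\<Sum>i<m. (z - l i) * T i)"
      using sym nonneg S T below above by (rule yang_trace_inequality)
    also have "\<dots> \<le> (\<Sum>i<m. (z - l i) * (\<beta> * l i))"
      using T_le below by (intro sum_mono mult_left_mono) auto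
    also have "\<dots> = \<gamma> * real N / 2 * (\<Sum>i<m. \<tau> * (z - l i) * l i)"
      unfolding sum_distrib_left \<tau>_def using assms by (intro sum.cong) (auto simp: field_simps)
    finally have "\<gamma> * real N / 2 * (\<Sum>i<m. (z - l i)\<^sup>2) \<le> \<gamma> * real N / 2 * (\<Sum>i<m. \<tau> * (z - l i) * l i)" .
    then have "(\<Sum>i<m. (z - l i)\<^sup>2 - \<tau> * (z - l i) * l i) \<le> 0"
      using assms by (simp add: sum_subtractf)
    moreover have "yang_sum lam m \<tau> 2 z = (\<Sum>i<m. (z - l i)\<^sup>2 - \<tau> * (z - l i) * l i)"
    proof -
      have "yang_sum lam m \<tau> 2 z = (\<Sum>i<m. (z - l i) powr 1 * (z - (1 + \<tau>) * l i))"
        unfolding yang_sum_def l_def by (simp add: sum.atLeast1_atMost_eq)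
      also have "\<dots> = (\<Sum>i<m. (z - l i)\<^sup>2 - \<tau> * (z - l i) * l i)"
        using below by (intro sum.cong) (auto simp: power2_eq_square algebra_simps)
      finally show ?thesis .
    qed
    ultimately show ?thesis by simp
  qed
  interpret yang_bound lam m \<tau>
  proof
    show "0 < lam i" if "i \<in> {1..m}" for i
      using l_pos[of "i - 1"] that by (simp add: l_def)
    show "yang_sum lam m \<tau> 2 (lam m) \<le> 0"
      using assms(4)[of m "m + 1"] assms(18) by (intro yang) auto
  qed (use assms \<tau> in auto)
  have f: "f_fun lam m N \<beta> \<gamma> p \<sigma> = 0 \<longleftrightarrow> g p \<sigma> = 0" if "lam m < \<sigma>" for p \<sigma>
    using f_fun_eq_yang_sum[of m lam \<sigma> N \<beta> \<gamma> p] l_le that m_pos by (force simp: \<tau>_def)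
  \<comment> \<open>Existence needs a point beyond \<open>lam m\<close> with
    \<open>g p \<le> 0\<close>. For \<open>p < 2\<close> one lies near \<open>lam m\<close>; for
    \<open>p = 2\<close> the trace inequality provides \<open>lam (m + 1)\<close> when the gap is
    open.\<close>
  have unique_zero: "\<exists>!\<sigma>. lam m < \<sigma> \<and> f_fun lam m N \<beta> \<gamma> p \<sigma> = 0"
    if p: "p \<le> 2" "p < 2 \<or> lam m < lam (m + 1)" for p
  proof -
    have "\<exists>s>lam m. g p s \<le> 0"
      using p(2)
    proof
      assume "p < 2"
      then show ?thesis using g_neg_near_last[of p] by (auto intro: less_imp_le)
    next
      assume "lam m < lam (m + 1)"
      then show ?thesis
        using yang[of "lam (m + 1)"] by (intro exI[of _ "lam (m + 1)"] conjI)
          (metis g_pos_mono less_imp_le not_less order.refl p(1))+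
    qed
    then obtain \<sigma> where "lam m < \<sigma>" "g p \<sigma> = 0" using g_zero_exists by blast
    then show ?thesis
      using g_zero_unique[OF p(1)] f by (intro ex1I[of _ \<sigma>]) auto
  qed
  have "lam (m + 1) \<le> \<sigma>2 \<and> \<sigma>2 \<le> \<sigma>1"
    if z: "lam m < \<sigma>1" "g p1 \<sigma>1 = 0" "lam m < \<sigma>2" "g p2 \<sigma>2 = 0" for \<sigma>1 \<sigma>2
  proof
    have p2: "p2 \<le> 2" using assms by simp
    show "lam (m + 1) \<le> \<sigma>2"
    proof (rule ccontr)
      \<comment> \<open>A zero before \<open>lam (m + 1)\<close> would make \<open>g p2\<close>,
        hence \<open>g 2\<close>, positive there, against the trace inequality.\<close>
      assume *: "\<not> lam (m + 1) \<le> \<sigma>2"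
      then have "0 < g p2 (lam (m + 1))"
        using g_crossing[of \<sigma>2 "lam (m + 1)" p2] z p2 by simp
      then have "0 < g 2 (lam (m + 1))"
        using g_pos_mono[of "lam (m + 1)" p2 2] z p2 * by simp
      then show False using yang[of "lam (m + 1)"] z * by simp
    qed
    show "\<sigma>2 \<le> \<sigma>1"
    proof (rule ccontr)
      \<comment> \<open>Raising the exponent at \<open>\<sigma>1\<close> gives
        \<open>g p2 \<sigma>1 \<ge> 0\<close>, so \<open>g p2\<close> has no zero beyond
        \<open>\<sigma>1\<close>.\<close>
      assume "\<not> \<sigma>2 \<le> \<sigma>1"
      moreover have "0 \<le> g p2 \<sigma>1"
        using g_nonneg_mono[of \<sigma>1 p1 p2] z assms by simp
      ultimately have "0 < g p2 \<sigma>2"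
        using g_crossing[of \<sigma>1 \<sigma>2 p2] z p2 by simp
      then show False using z by simp
    qed
  qed
  moreover have "\<forall>p\<in>{p1, p2}. p \<le> 2" using assms by auto
  ultimately show ?thesis
    using unique_zero f by blast
qed

end
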